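(* Let $L^1:\mathbb{R}^{1\times d}\to\mathbb{R}_{\ge0}$ be the training loss of the linear model with a single output. Assume that $\frac{dL^1}{dW}$ does not vanish at $W=0$, and is continuous on some neighborhood around this point. For a given $N\in\mathbb{N}$, $N>2$, define $$F(W):=\|W\|_2^{2-\frac2N}\cdot\Big(\frac{dL^1}{dW}(W)+(N-1)\cdot Pr_W\Big\{\frac{dL^1}{dW}(W)\Big\}\Big),$$ where $Pr_W:\mathbb{R}^{1\times d}\to\mathbb{R}^{1\times d}$ is the projection onto the direction of $W$: $$Pr_W\{V\}:=\begin{cases}\dfrac{W}{\|W\|_2}V^\top\cdot\dfrac{W}{\|W\|_2}, & W\ne0,\\[2mm] 0, & W=0.\end{cases}$$ Then, there exists no function (of $W$) whose gradient field is $F(\cdot)$.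
   Context: Training loss: given training data $(\mathbf{x}^{(i)},y^{(i)})\in\mathbb{R}^d\times\mathbb{R}$, $i=1,\dots,m$, and a point-wise loss $l:\mathbb{R}\times\mathbb{R}\to\mathbb{R}_{\ge0}$, $L^1(W):=\frac1m\sum_{i=1}^m l(W\mathbf{x}^{(i)},y^{(i)})$ for $W\in\mathbb{R}^{1\times d}$. $\frac{dL^1}{dW}(W)\in\mathbb{R}^{1\times d}$ is the gradient of $L^1$ at $W$, written as a row vector of partial derivatives, and $\|\cdot\|_2$ is the Euclidean norm.
   Formalization: The dimension is assumed to satisfy d ≥ 2; for d = 1 the claim is false, since F(W) = N|W|^{2-2/N} (L^1)'(W) then has an antiderivative (e.g. squared loss with m = 1, x = y = 1). *)

theory Defs
  imports "HOL-Analysis.Analysis"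
begin

text \<open>
  Row vectors, i.e. 1-by-d matrices, have the type \<^typ>\<open>real^'d^1\<close>. Its library norm and inner
  product are the Euclidean (Frobenius) ones.
\<close>

text \<open>The training examples are indexed by \<open>1, \<dots>, m\<close>.\<close>

definition training_loss ::
    "(real \<Rightarrow> real \<Rightarrow> real) \<Rightarrow> nat \<Rightarrow> (nat \<Rightarrow> real^'d) \<Rightarrow> (nat \<Rightarrow> real) \<Rightarrow> real^'d^1 \<Rightarrow> real" where
  "training_loss l m x y W = (1 / real m) * (\<Sum>i=1..m. l ((W *v x i) $ 1) (y i))"

text \<open>
  The row vector of partial derivatives. As \<^const>\<open>deriv\<close> is total, this is meaningful only
  where \<open>f\<close> is differentiable, i.e. on \<open>gradient_domain f\<close>.
\<close>

definition gradient :: "(real^'d^1 \<Rightarrow> real) \<Rightarrow> real^'d^1 \<Rightarrow> real^'d^1" where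
  "gradient f W = (\<chi> i j. deriv (\<lambda>t. f (W + t *\<^sub>R axis i (axis j 1))) 0)"

definition gradient_domain :: "(real^'d^1 \<Rightarrow> real) \<Rightarrow> (real^'d^1) set" where
  "gradient_domain f = {W. f differentiable (at W)}"

definition is_gradient_field_on ::
    "(real^'d^1 \<Rightarrow> real^'d^1) \<Rightarrow> (real^'d^1) set \<Rightarrow> (real^'d^1 \<Rightarrow> real) \<Rightarrow> bool" where
  "is_gradient_field_on F D \<phi> \<longleftrightarrow> (\<forall>W\<in>D. \<phi> differentiable (at W) \<and> gradient \<phi> W = F W)"

lemma GDERIV_gradient:
  fixes f :: "real^'d^1 \<Rightarrow> real"
  assumes "f differentiable (at W)"
  shows "GDERIV f W :> gradient f W"
proof -
  define f' where "f' = frechet_derivative f (at W)"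
  have f': "(f has_derivative f') (at W)"
    using assms unfolding f'_def frechet_derivative_works .
  then have lin: "linear f'"
    by (rule has_derivative_linear)
  have part: "gradient f W $ i $ j = f' (axis i (axis j 1))" for i j
  proof -
    let ?e = "axis i (axis j 1) :: real^'d^1"
    have "((\<lambda>t. f (W + t *\<^sub>R ?e)) has_derivative (\<lambda>t. f' (t *\<^sub>R ?e))) (at 0)"
      by (rule has_derivative_compose[where g = f and f = "\<lambda>t. W + t *\<^sub>R ?e"])
        (use f' in \<open>auto intro!: derivative_eq_intros\<close>)
    then have "((\<lambda>t. f (W + t *\<^sub>R ?e)) has_real_derivative f' ?e) (at 0)"
      unfolding has_field_derivative_def
      by (rule has_derivative_eq_rhs) (simp add: linear_scale[OF lin] mult.commute fun_eq_iff)
    then show ?thesis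
      unfolding gradient_def by (simp add: DERIV_imp_deriv)
  qed
  have "f' h = h \<bullet> gradient f W" for h
  proof -
    have "h = (\<Sum>j\<in>UNIV. h $ 1 $ j *\<^sub>R axis 1 (axis j 1))"
      by (simp add: vec_eq_iff axis_def if_distrib[of "\<lambda>v. v $ _"] if_distrib[of "(*) _"]
          forall_1 cong: if_cong)
    then have "f' h = f' (\<Sum>j\<in>UNIV. h $ 1 $ j *\<^sub>R axis 1 (axis j 1))"
      by simp
    also have "\<dots> = (\<Sum>j\<in>UNIV. h $ 1 $ j * f' (axis 1 (axis j 1)))"
      by (simp add: linear_sum[OF lin] linear_scale[OF lin])
    also have "\<dots> = h \<bullet> gradient f W"
      by (simp add: inner_vec_def part)
    finally show ?thesis .
  qed
  then show ?thesis
    using f' by (simp add: gderiv_def has_derivative_eq_rhs fun_eq_iff)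
qed

definition Pr :: "real^'d^1 \<Rightarrow> real^'d^1 \<Rightarrow> real^'d^1" where
  "Pr W V = (if W = 0 then 0
     else (((1 / norm W) *\<^sub>R W) ** transpose V) ** ((1 / norm W) *\<^sub>R W))"

text \<open>
  In the second argument, \<open>G\<close> plays the role of the gradient field of the training loss.
  The exponent is positive in the relevant case \<open>N > 2\<close>, so \<open>0 powr _ = 0\<close> is the correct value.
\<close>

definition end_to_end_field ::
    "nat \<Rightarrow> (real^'d^1 \<Rightarrow> real^'d^1) \<Rightarrow> real^'d^1 \<Rightarrow> real^'d^1" where
  "end_to_end_field N G W =
     norm W powr (2 - 2 / real N) *\<^sub>R (G W + (real N - 1) *\<^sub>R Pr W (G W))"

end

theory Submission
  imports Defs
begin

text \<open>
  Write \<open>a = 2 - 2/N\<close> and \<open>c = G 0 \<noteq> 0\<close>, where \<open>G\<close> is the gradient of the loss. Near \<open>0\<close> the field is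
  \<open>|W|\<^sup>a (c + (N - 1) Pr\<^sub>W c)\<close> up to \<open>o(|W|\<^sup>a)\<close>. The mean value theorem along rays determines a
  potential up to \<open>o(|W|\<^sup>a\<^sup>+\<^sup>1)\<close>: it must be \<open>p (c \<bullet> W) |W|\<^sup>a\<close> with \<open>p = N / (a + 1)\<close>. The gradient of
  this function differs from the field by the purely tangential term \<open>(1 - p) |W|\<^sup>a (c - Pr\<^sub>W c)\<close>,
  and \<open>p \<noteq> 1\<close> because \<open>N\<^sup>2 - 3 N + 2 \<noteq> 0\<close>. The mean value theorem along a segment in direction
  \<open>c\<close>, starting at a point orthogonal to \<open>c\<close>, then gives a contradiction.
\<close>

text \<open>Multiplies the component of \<open>V\<close> along \<open>W\<close> by \<open>n\<close>
  and keeps the orthogonal one. No case split is needed: at \<open>W = 0\<close> the added multiple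
  of \<open>W\<close> vanishes.\<close>

definition radial_stretch :: "real \<Rightarrow> 'a::real_inner \<Rightarrow> 'a \<Rightarrow> 'a" where
  "radial_stretch n W V = V + ((n - 1) * ((W \<bullet> V) / (norm W)\<^sup>2)) *\<^sub>R W"

text \<open>By Cauchy-Schwarz the projection onto \<open>W\<close> does not increase the norm; the
  triangle inequality then gives \<open>1 + (n - 1)\<close>.\<close>

lemma norm_radial_stretch_le:
  assumes "n \<ge> 1"
  shows "norm (radial_stretch n W V) \<le> n * norm V"
proof -
  have "norm (((W \<bullet> V) / (norm W)\<^sup>2) *\<^sub>R W) \<le> norm V"
  proof (cases "W = 0")
    case False
    have "\<bar>W \<bullet> V\<bar> \<le> norm W * norm V"
      by (rule Cauchy_Schwarz_ineq2)
    with False show ?thesis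
      by (simp add: power2_eq_square field_simps)
  qed simp
  then have "norm (((n - 1) * ((W \<bullet> V) / (norm W)\<^sup>2)) *\<^sub>R W) \<le> (n - 1) * norm V"
    using assms mult_left_mono[of "norm (((W \<bullet> V) / (norm W)\<^sup>2) *\<^sub>R W)" "norm V" "n - 1"]
    by (simp add: abs_mult mult.assoc)
  then have "norm (radial_stretch n W V) \<le> norm V + (n - 1) * norm V"
    unfolding radial_stretch_def by (rule norm_triangle_mono[OF order_refl])
  then show ?thesis
    by (simp add: algebra_simps)
qed

text \<open>The gradient is asked for only inside the segment, so that a ray may start at
  \<open>0\<close>, where only continuity of the function will be at hand.\<close>

lemma GDERIV_segment_mean_value:
  fixes f :: "'a::real_inner \<Rightarrow> real"
  assumes cont: "continuous_on (closed_segment A B) f"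
    and deriv: "\<And>t. 0 < t \<Longrightarrow> t < 1 \<Longrightarrow> GDERIV f (A + t *\<^sub>R (B - A)) :> D (A + t *\<^sub>R (B - A))"
  obtains t where "0 < t" "t < 1" "f B - f A = (B - A) \<bullet> D (A + t *\<^sub>R (B - A))"
proof -
  have seg: "(\<lambda>t. A + t *\<^sub>R (B - A)) ` {0..1} \<subseteq> closed_segment A B"
    unfolding closed_segment_image_interval by (auto simp: algebra_simps)
  let ?g = "\<lambda>t. f (A + t *\<^sub>R (B - A))"
  have g: "continuous_on {0..1} ?g"
    by (rule continuous_on_compose2[OF cont _ seg]) (intro continuous_intros)
  have g': "(?g has_derivative (\<lambda>h. (h *\<^sub>R (B - A)) \<bullet> D (A + t *\<^sub>R (B - A)))) (at t)"
    if "0 < t" "t < 1" for t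
    by (rule has_derivative_compose[where g = f and f = "\<lambda>t. A + t *\<^sub>R (B - A)"])
      (use deriv[OF that] in \<open>auto intro!: derivative_eq_intros simp: gderiv_def\<close>)
  obtain t where "0 < t" "t < 1" "?g 1 - ?g 0 = ((1 - 0) *\<^sub>R (B - A)) \<bullet> D (A + t *\<^sub>R (B - A))"
    by (rule mvt[OF zero_less_one g g'])
  then show thesis
    using that by simp
qed

text \<open>The gradient of the candidate potential is \<open>p * norm W powr a\<close> times
  \<open>radial_stretch (a + 1) W c\<close>.\<close>

lemma GDERIV_inner_norm_powr:
  fixes c W :: "'a::real_inner"
  assumes "W \<noteq> 0"
  shows "GDERIV (\<lambda>W. p * (c \<bullet> W) * norm W powr a) W
    :> (p * norm W powr a) *\<^sub>R (c + (a * ((W \<bullet> c) / (norm W)\<^sup>2)) *\<^sub>R W)"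
proof -
  have "((\<lambda>W. norm W powr a) has_derivative (\<lambda>h. norm W powr a * (a * (h \<bullet> sgn W) / norm W))) (at W)"
    by (rule has_derivative_eq_rhs[OF has_derivative_powr[OF has_derivative_norm has_derivative_const]])
      (use assms in \<open>auto simp: fun_eq_iff inner_commute\<close>)
  then have "((\<lambda>W. p * (c \<bullet> W) * norm W powr a) has_derivative
      (\<lambda>h. p * (c \<bullet> W) * (norm W powr a * (a * (h \<bullet> sgn W) / norm W)) + p * (c \<bullet> h) * norm W powr a)) (at W)"
    by (intro has_derivative_mult has_derivative_mult_right has_derivative_inner_right
        has_derivative_ident)
  then show ?thesis
    unfolding gderiv_def
    by (rule has_derivative_eq_rhs)
      (simp add: fun_eq_iff sgn_div_norm inner_add inner_commute power2_eq_square divide_simps algebra_simps)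
qed

text \<open>The field stretches by \<open>n\<close>, gradients of the candidates by
  \<open>a + 1\<close>; a factor \<open>p\<close> can match only the radial parts, and
  \<open>n \<noteq> a + 1\<close> keeps the tangential parts apart. The vector \<open>u\<close>
  gives a base point from which moving along \<open>G 0\<close> is not radial.\<close>

lemma no_potential_of_stretched_field:
  fixes G :: "'a::real_inner \<Rightarrow> 'a" and \<phi> :: "'a \<Rightarrow> real"
  assumes "a > 0" and "n \<ge> 1" and "n \<noteq> a + 1"
    and G: "isCont G 0" and "G 0 \<noteq> 0"
    and u: "norm u = 1" "u \<bullet> G 0 = 0"
    and ev: "\<forall>\<^sub>F W in nhds 0. GDERIV \<phi> W :> norm W powr a *\<^sub>R radial_stretch n W (G W)"
  shows False
proof -
  define c where "c = G 0"
  define q where "q = c \<bullet> c"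
  \<comment> \<open>Chosen so that \<open>p * (a + 1) = n\<close>: the radial parts then agree, and
    \<open>k\<close> measures the tangential mismatch.\<close>
  define p where "p = n / (a + 1)"
  define k where "k = 1 - p"
  define \<beta> where "\<beta> = norm (u + c)"
  \<comment> \<open>The first summand will come from the two endpoint values of
    \<open>\<psi>\<close>, the second from the error of \<open>G\<close> along the segment. The
    choice of \<open>\<eta>\<close> makes the total error \<open>n * \<eta> * M\<close> half of the
    lower bound \<open>e\<close>.\<close>
  define M where "M = 2 * \<beta> powr (a + 1) + norm c * \<beta> powr a"
  define e where "e = \<bar>k\<bar> * (q / \<beta>\<^sup>2)"
  define \<eta> where "\<eta> = e / (2 * n * M)"
  have uc: "u \<bullet> c = 0" "c \<bullet> u = 0" and uu: "u \<bullet> u = 1"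
    using u by (auto simp: c_def inner_commute norm_eq_1)
  have q: "q > 0"
    using \<open>G 0 \<noteq> 0\<close> by (simp add: q_def c_def)
  have k: "k \<noteq> 0"
    using assms(1,3) by (simp add: k_def p_def field_simps)
  have norm_line: "(norm (u + t *\<^sub>R c))\<^sup>2 = 1 + t\<^sup>2 * q" for t
    unfolding power2_norm_eq_inner
    by (simp add: inner_add uc uu q_def power2_eq_square)
  have \<beta>2: "\<beta>\<^sup>2 = 1 + q"
    using norm_line[of 1] by (simp add: \<beta>_def)
  then have \<beta>: "\<beta> \<ge> 1"
    using q power2_le_imp_le[of 1 \<beta>] by (simp add: \<beta>_def)
  have M: "M > 0"
    using \<beta> by (simp add: M_def add_pos_nonneg)
  have e: "e > 0"
    using k q \<beta> by (simp add: e_def)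
  then have \<eta>: "\<eta> > 0"
    using M \<open>n \<ge> 1\<close> by (simp add: \<eta>_def)

  \<comment> \<open>Difference from the candidate potential\<close>
  define \<psi> where "\<psi> W = \<phi> W - \<phi> 0 - p * (c \<bullet> W) * norm W powr a" for W
  \<comment> \<open>The gradient of \<open>\<psi>\<close> away from \<open>0\<close>: the error from
    replacing \<open>G W\<close> by \<open>c\<close>, plus the tangential mismatch.\<close>
  define D where "D W = norm W powr a *\<^sub>R (radial_stretch n W (G W - c)
    + k *\<^sub>R (c - ((W \<bullet> c) / (norm W)\<^sup>2) *\<^sub>R W))" for W
  obtain \<delta>1 where \<delta>1: "\<delta>1 > 0"
    "\<And>W. norm W < \<delta>1 \<Longrightarrow> GDERIV \<phi> W :> norm W powr a *\<^sub>R radial_stretch n W (G W)"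
    using ev unfolding eventually_nhds_metric by (auto simp: dist_norm)
  obtain \<delta>2 where \<delta>2: "\<delta>2 > 0" "\<And>W. norm W < \<delta>2 \<Longrightarrow> norm (G W - c) < \<eta>"
    using G \<eta> unfolding continuous_at_eps_delta by (force simp: dist_norm c_def)
  define \<delta> where "\<delta> = min \<delta>1 \<delta>2"
  have \<delta>: "\<delta> > 0"
    using \<delta>1 \<delta>2 by (simp add: \<delta>_def)
  have cont: "continuous_on (ball 0 \<delta>) \<psi>"
  proof -
    have "continuous_on (ball 0 \<delta>) \<phi>"
      using \<delta>1(2) by (intro continuous_at_imp_continuous_on ballI)
        (auto simp: \<delta>_def gderiv_def dest!: has_derivative_continuous)
    then show ?thesis
      \<comment> \<open>Positivity of \<open>a\<close> is what makes the power continuous at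
        \<open>0\<close>.\<close>
      unfolding \<psi>_def using \<open>a > 0\<close> by (intro continuous_intros continuous_on_powr') auto
  qed
  have \<psi>: "GDERIV \<psi> W :> D W" if W: "W \<noteq> 0" "norm W < \<delta>" for W
  proof -
    have "GDERIV \<phi> W :> norm W powr a *\<^sub>R radial_stretch n W (G W)"
      using W by (intro \<delta>1) (simp add: \<delta>_def)
    then have "GDERIV \<psi> W :> norm W powr a *\<^sub>R radial_stretch n W (G W) - 0
        - (p * norm W powr a) *\<^sub>R (c + (a * ((W \<bullet> c) / (norm W)\<^sup>2)) *\<^sub>R W)"
      unfolding \<psi>_def
      by (intro GDERIV_diff GDERIV_const GDERIV_inner_norm_powr W)
    \<comment> \<open>Since \<open>n - p * a = p\<close>, the leftover multiples of \<open>c\<close>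
      and of its projection are opposite and combine into the tangential part.\<close>
    moreover have "n - 1 - p * a = - k"
      using \<open>a > 0\<close> by (simp add: p_def k_def field_simps)
    then have "D W = norm W powr a *\<^sub>R (radial_stretch n W (G W - c) + k *\<^sub>R c
        + ((n - 1 - p * a) * ((W \<bullet> c) / (norm W)\<^sup>2)) *\<^sub>R W)"
      by (simp add: D_def scaleR_diff_right scaleR_add_right)
    then have "D W = norm W powr a *\<^sub>R radial_stretch n W (G W) - 0
        - (p * norm W powr a) *\<^sub>R (c + (a * ((W \<bullet> c) / (norm W)\<^sup>2)) *\<^sub>R W)"
      by (simp add: radial_stretch_def k_def inner_diff_right diff_divide_distrib add_divide_distrib algebra_simps)
    ultimately show ?thesis by simp
  qed
  have stretch: "\<bar>V \<bullet> radial_stretch n W (G W - c)\<bar> \<le> norm V * (n * \<eta>)" if "norm W < \<delta>" for V W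
  proof -
    have "norm (radial_stretch n W (G W - c)) \<le> n * norm (G W - c)"
      using \<open>n \<ge> 1\<close> by (rule norm_radial_stretch_le)
    also have "\<dots> \<le> n * \<eta>"
      using \<delta>2(2)[of W] that \<open>n \<ge> 1\<close> by (simp add: \<delta>_def)
    finally show ?thesis
      by (meson Cauchy_Schwarz_ineq2 order_trans mult_left_mono norm_ge_zero)
  qed

  \<comment> \<open>Growth bound along rays\<close>
  have radial: "\<bar>\<psi> W\<bar> \<le> n * \<eta> * norm W powr (a + 1)" if W: "norm W < \<delta>" for W
  proof (cases "W = 0")
    case True
    then show ?thesis by (simp add: \<psi>_def)
  next
    case False
    have "closed_segment 0 W \<subseteq> ball 0 \<delta>"
      using W \<delta> by (intro closed_segment_subset) auto
    then have "continuous_on (closed_segment 0 W) \<psi>"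
      using cont continuous_on_subset by blast
    moreover have "GDERIV \<psi> (0 + t *\<^sub>R (W - 0)) :> D (0 + t *\<^sub>R (W - 0))" if "0 < t" "t < 1" for t
    proof -
      have "norm (t *\<^sub>R W) \<le> norm W" using that by (simp add: mult_left_le_one_le)
      then have "norm (t *\<^sub>R W) < \<delta>" using W by (rule order_le_less_trans)
      then show ?thesis using \<psi>[of "t *\<^sub>R W"] that False by simp
    qed
    ultimately obtain t where t: "0 < t" "t < 1" "\<psi> W - \<psi> 0 = (W - 0) \<bullet> D (0 + t *\<^sub>R (W - 0))"
      by (rule GDERIV_segment_mean_value)
    let ?V = "t *\<^sub>R W"
    have V: "norm ?V \<le> norm W" using t by (simp add: mult_left_le_one_le)
    \<comment> \<open>On a ray the tangential mismatch is orthogonal to the direction of motion, so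
      only the error term survives.\<close>
    have "W \<bullet> (c - ((?V \<bullet> c) / (norm ?V)\<^sup>2) *\<^sub>R ?V) = 0"
      using t False by (simp add: inner_diff_right power2_norm_eq_inner power2_eq_square[of t] divide_simps)
    then have "\<psi> W = norm ?V powr a * (W \<bullet> radial_stretch n ?V (G ?V - c))"
      using t by (simp add: D_def \<psi>_def inner_add_right)
    then have "\<bar>\<psi> W\<bar> \<le> norm ?V powr a * (norm W * (n * \<eta>))"
      using stretch[of ?V W] V W by (simp add: abs_mult mult_left_mono)
    also have "\<dots> \<le> norm W powr a * (norm W * (n * \<eta>))"
      using V \<open>a > 0\<close> \<open>n \<ge> 1\<close> \<eta> by (intro mult_right_mono powr_mono2) auto
    also have "\<dots> = n * \<eta> * norm W powr (a + 1)"
      by (simp add: powr_add)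
    finally show ?thesis .
  qed

  \<comment> \<open>Contradiction on a segment transversal to the rays\<close>
  define r where "r = \<delta> / (2 * \<beta>)"
  have r: "r > 0" "r * \<beta> < \<delta>"
    using \<delta> \<beta> by (auto simp: r_def)
  \<comment> \<open>The length grows with \<open>t\<close>, from \<open>r\<close> to
    \<open>r * \<beta>\<close>; the lower bound keeps the segment away from
    \<open>0\<close>.\<close>
  have line: "norm (r *\<^sub>R (u + t *\<^sub>R c)) \<le> r * \<beta>" "r \<le> norm (r *\<^sub>R (u + t *\<^sub>R c))"
    if "0 \<le> t" "t \<le> 1" for t
  proof -
    have "t\<^sup>2 * q \<le> q"
      using that q by (simp add: power_le_one mult_left_le_one_le)
    then have "(norm (u + t *\<^sub>R c))\<^sup>2 \<le> \<beta>\<^sup>2" "1\<^sup>2 \<le> (norm (u + t *\<^sub>R c))\<^sup>2"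
      using q by (simp_all add: norm_line \<beta>2)
    then have "norm (u + t *\<^sub>R c) \<le> \<beta>" "1 \<le> norm (u + t *\<^sub>R c)"
      using \<beta> by - (rule power2_le_imp_le; simp)+
    then show "norm (r *\<^sub>R (u + t *\<^sub>R c)) \<le> r * \<beta>" "r \<le> norm (r *\<^sub>R (u + t *\<^sub>R c))"
      using r by simp_all
  qed
  let ?A = "r *\<^sub>R u" and ?B = "r *\<^sub>R (u + c)"
  have BA: "?B - ?A = r *\<^sub>R c" "?A + t *\<^sub>R r *\<^sub>R c = r *\<^sub>R (u + t *\<^sub>R c)" for t
    by (simp_all add: algebra_simps)
  have ends: "norm ?A \<le> r * \<beta>" "norm ?B \<le> r * \<beta>"
    using line[of 0] line[of 1] by simp_all
  have "closed_segment ?A ?B \<subseteq> ball 0 \<delta>"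
    using order_le_less_trans[OF ends(1) r(2)] order_le_less_trans[OF ends(2) r(2)]
    by (intro closed_segment_subset) auto
  then have "continuous_on (closed_segment ?A ?B) \<psi>"
    using cont continuous_on_subset by blast
  moreover have "GDERIV \<psi> (?A + t *\<^sub>R (?B - ?A)) :> D (?A + t *\<^sub>R (?B - ?A))" if "0 < t" "t < 1" for t
  proof -
    have "norm (r *\<^sub>R (u + t *\<^sub>R c)) < \<delta>" "norm (r *\<^sub>R (u + t *\<^sub>R c)) > 0"
      using line[of t] that r by linarith+
    then show ?thesis unfolding BA zero_less_norm_iff by (intro \<psi>)
  qed
  ultimately obtain t where t: "0 < t" "t < 1"
    and "\<psi> ?B - \<psi> ?A = (?B - ?A) \<bullet> D (?A + t *\<^sub>R (?B - ?A))"
    by (rule GDERIV_segment_mean_value)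
  define V where "V = r *\<^sub>R (u + t *\<^sub>R c)"
  define s where "s = c \<bullet> radial_stretch n V (G V - c)"
  have V: "norm V \<le> r * \<beta>" "r \<le> norm V"
    using line[of t] t by (auto simp: V_def)
  have Vn: "(norm V)\<^sup>2 = r\<^sup>2 * (1 + t\<^sup>2 * q)"
    by (simp add: V_def power_mult_distrib norm_line)
  have pos: "1 + t\<^sup>2 * q > 0"
    using q by (simp add: add_pos_nonneg)
  \<comment> \<open>The squared length of the part of \<open>c\<close> orthogonal to
    \<open>V\<close>, the amount by which the mismatch is felt in direction
    \<open>c\<close>.\<close>
  have "c \<bullet> (c - ((V \<bullet> c) / (norm V)\<^sup>2) *\<^sub>R V) = q - (V \<bullet> c)\<^sup>2 / (norm V)\<^sup>2"
    by (simp add: inner_diff_right inner_commute q_def power2_eq_square)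
  also have "\<dots> = q - (r * t * q)\<^sup>2 / (norm V)\<^sup>2"
    by (simp add: V_def inner_add_left uc q_def mult.assoc)
  also have "\<dots> = q - t\<^sup>2 * q\<^sup>2 / (1 + t\<^sup>2 * q)"
    using r by (simp add: Vn power_mult_distrib)
  also have "\<dots> = q / (1 + t\<^sup>2 * q)"
    using pos by (simp add: field_simps power2_eq_square)
  finally have "\<psi> ?B - \<psi> ?A = r * norm V powr a * (s + k * (q / (1 + t\<^sup>2 * q)))"
    using \<open>\<psi> ?B - \<psi> ?A = _\<close> unfolding BA V_def[symmetric]
    by (simp add: D_def inner_add_right s_def algebra_simps)
  then have "r * norm V powr a * (k * (q / (1 + t\<^sup>2 * q))) = \<psi> ?B - \<psi> ?A - r * norm V powr a * s"
    by (simp add: algebra_simps)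
  then have "\<bar>r * norm V powr a * (k * (q / (1 + t\<^sup>2 * q)))\<bar>
      \<le> \<bar>\<psi> ?B\<bar> + \<bar>\<psi> ?A\<bar> + \<bar>r * norm V powr a * s\<bar>"
    by (rule ssubst)
      (rule order_trans[OF abs_triangle_ineq4 add_right_mono[OF abs_triangle_ineq4]])
  then have up: "r * norm V powr a * (\<bar>k\<bar> * (q / (1 + t\<^sup>2 * q)))
      \<le> \<bar>\<psi> ?B\<bar> + \<bar>\<psi> ?A\<bar> + r * norm V powr a * \<bar>s\<bar>"
    using r q pos by (simp add: abs_mult)
  have end_bound: "\<bar>\<psi> W\<bar> \<le> n * \<eta> * (r * \<beta>) powr (a + 1)" if "norm W \<le> r * \<beta>" for W
  proof -
    have "\<bar>\<psi> W\<bar> \<le> n * \<eta> * norm W powr (a + 1)"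
      using that r(2) by (intro radial) linarith
    also have "\<dots> \<le> n * \<eta> * (r * \<beta>) powr (a + 1)"
      using that \<open>n \<ge> 1\<close> \<open>a > 0\<close> \<eta> by (intro mult_left_mono powr_mono2) auto
    finally show ?thesis .
  qed
  have "norm V powr a * \<bar>s\<bar> \<le> (r * \<beta>) powr a * (norm c * (n * \<eta>))"
    using V r \<open>a > 0\<close> stretch[of V c] unfolding s_def
    by (intro mult_mono powr_mono2) auto
  then have "r * norm V powr a * \<bar>s\<bar> \<le> r * ((r * \<beta>) powr a * (norm c * (n * \<eta>)))"
    using r by (simp add: mult.assoc)
  with up end_bound[OF ends(1)] end_bound[OF ends(2)]
  have "r * norm V powr a * (\<bar>k\<bar> * (q / (1 + t\<^sup>2 * q)))
      \<le> 2 * (n * \<eta> * (r * \<beta>) powr (a + 1)) + r * ((r * \<beta>) powr a * (norm c * (n * \<eta>)))"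
    by linarith
  \<comment> \<open>Both sides scale like \<open>r powr (a + 1)\<close>, so one fixed
    \<open>r\<close> suffices and no limit is taken.\<close>
  also have "\<dots> = r powr (a + 1) * (n * \<eta> * M)"
    using r \<beta> by (simp add: M_def powr_mult powr_add algebra_simps)
  finally have le: "r * norm V powr a * (\<bar>k\<bar> * (q / (1 + t\<^sup>2 * q))) \<le> r powr (a + 1) * (n * \<eta> * M)" .
  have "r powr (a + 1) * (\<bar>k\<bar> * (q / \<beta>\<^sup>2)) = r * r powr a * (\<bar>k\<bar> * (q / \<beta>\<^sup>2))"
    using r by (simp add: powr_add)
  also have "\<dots> \<le> r * norm V powr a * (\<bar>k\<bar> * (q / (1 + t\<^sup>2 * q)))"
  proof -
    have "t\<^sup>2 * q \<le> q"
      using t q by (simp add: power_le_one mult_left_le_one_le)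
    then show ?thesis
      using V r q pos \<open>a > 0\<close>
      by (intro mult_mono mult_left_mono powr_mono2 divide_left_mono) (auto simp: \<beta>2)
  qed
  also note le
  \<comment> \<open>After cancelling the power of \<open>r\<close> this reads
    \<open>e \<le> e / 2\<close>.\<close>
  finally have "\<bar>k\<bar> * (q / \<beta>\<^sup>2) \<le> n * \<eta> * M"
    by (rule mult_left_le_imp_le) (use r in simp)
  moreover have "n * \<eta> * M = e / 2"
    using M \<open>n \<ge> 1\<close> by (simp add: \<eta>_def)
  ultimately show False
    using e unfolding e_def[symmetric] by simp
qed

text \<open>The product of \<open>W\<close> with the transpose of \<open>V\<close> is the 1-by-1
  matrix with entry \<open>W \<bullet> V\<close>; the two normalisations give the squared
  norm.\<close>

lemma Pr_eq_inner: "Pr W V = ((W \<bullet> V) / (norm W)\<^sup>2) *\<^sub>R W"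
  by (auto simp: Pr_def vec_eq_iff matrix_matrix_mult_def transpose_def inner_vec_def forall_1
      power2_eq_square sum_distrib_left sum_divide_distrib sum_distrib_right
      intro!: sum.cong simp: field_simps)

theorem theorem2:
  fixes l :: "real \<Rightarrow> real \<Rightarrow> real"
    and m N :: nat
    and x :: "nat \<Rightarrow> real^'d"
    and y :: "nat \<Rightarrow> real"
    and L :: "real^'d^1 \<Rightarrow> real"
  assumes "CARD('d) \<ge> 2"
    and "m \<ge> 1"
    and "\<And>a b. l a b \<ge> 0"
    and "L = training_loss l m x y"
    and "\<exists>S. open S \<and> 0 \<in> S \<and> S \<subseteq> gradient_domain L \<and> continuous_on S (gradient L)"
    and "gradient L 0 \<noteq> 0"
    and "N > 2"
  shows "\<not> (\<exists>\<phi>. is_gradient_field_on (end_to_end_field N (gradient L)) (gradient_domain L) \<phi>)"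
proof
  assume "\<exists>\<phi>. is_gradient_field_on (end_to_end_field N (gradient L)) (gradient_domain L) \<phi>"
  then obtain \<phi> where \<phi>: "is_gradient_field_on (end_to_end_field N (gradient L)) (gradient_domain L) \<phi>" ..
  obtain S where S: "open S" "0 \<in> S" "S \<subseteq> gradient_domain L" "continuous_on S (gradient L)"
    using assms(5) by blast
  \<comment> \<open>Dimension at least two provides a direction orthogonal to the gradient at
    \<open>0\<close>.\<close>
  have "DIM(real^'d^1) \<ge> 2"
    using assms(1) by simp
  then obtain v where v: "v \<noteq> 0" "orthogonal (gradient L 0) v"
    using orthogonal_to_vector_exists by blast
  have "norm (sgn v) = 1" "sgn v \<bullet> gradient L 0 = 0"
    using v by (auto simp: norm_sgn sgn_div_norm orthogonal_def inner_commute)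
  moreover have "2 - 2 / real N > 0" "real N \<ge> 1"
    using \<open>N > 2\<close> by (auto simp: field_simps)
  moreover have "real N \<noteq> 2 - 2 / real N + 1"
  proof
    assume "real N = 2 - 2 / real N + 1"
    \<comment> \<open>Clearing the denominator leaves only the roots 1 and 2, both excluded by
      \<open>N > 2\<close>.\<close>
    then have "(real N - 1) * (real N - 2) = 0"
      using \<open>N > 2\<close> by (simp add: field_simps)
    then show False
      using \<open>N > 2\<close> by simp
  qed
  moreover have "isCont (gradient L) 0"
    using S by (simp add: continuous_on_eq_continuous_at)
  moreover have "\<forall>\<^sub>F W in nhds 0. GDERIV \<phi> W :>
      norm W powr (2 - 2 / real N) *\<^sub>R radial_stretch (real N) W (gradient L W)"
    using eventually_nhds_in_open[OF S(1,2)]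
  proof eventually_elim
    case (elim W)
    then have "\<phi> differentiable (at W)" "gradient \<phi> W = end_to_end_field N (gradient L) W"
      using \<phi> S(3) by (auto simp: is_gradient_field_on_def)
    then show ?case
      using GDERIV_gradient[of \<phi> W]
      by (simp add: end_to_end_field_def radial_stretch_def Pr_eq_inner)
  qed
  ultimately show False
    using no_potential_of_stretched_field assms(6) by blast
qed

end
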